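(* Let $d\ge2$, let $a_1,\dots,a_d>0$, $a=\sum_{i=1}^d a_i$, and let $\rho\ge1$ be an integer. Let $K_v$ be the Schur clique of $(a_1,\dots,a_d)$ and $\widehat K_v$ the random CAST-$\rho$ update. Then $\mathbb E[\widehat K_v]=K_v$.
   Context: $\mathbf e_1,\dots,\mathbf e_d$ is the standard basis of $\mathbb R^d$. The Schur clique is the $d\times d$ Laplacian $$K_v=\sum_{1\le i<j\le d}\frac{a_ia_j}{a}(\mathbf e_i-\mathbf e_j)(\mathbf e_i-\mathbf e_j)^\top .$$ (It arises from eliminating a pivot vertex $v$ with neighbors $u_1,\dots,u_d$, identified with $[d]$, and incident edge weights $a_i$.) CAST-$\rho$ update. For each $i\in[d]$ let $P_i=\{(i,1),\dots,(i,\rho)\}$ be a block of $\rho$ auxiliary copies, each $p\in P_i$ having conductance $c_p=a_i/\rho$ and label $\phi(p)=i$. Let $P=\bigcup_i P_i$. The expanded Schur clique is the complete graph on $P$ with edge weights $w^{\mathrm{exp}}_{pq}=c_pc_q/a$ for $p\ne q$. Let $T$ be a random spanning tree of it with $\mathbb P(T)\propto\prod_{(p,q)\in T}w^{\mathrm{exp}}_{pq}$. Then $$\widehat K_v=\sum_{(p,q)\in T,\ \phi(p)\ne\phi(q)}\frac{c_pc_q}{c_p+c_q}\,(\mathbf e_{\phi(p)}-\mathbf e_{\phi(q)})(\mathbf e_{\phi(p)}-\mathbf e_{\phi(q)})^\top .$$ *)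

theory Defs
  imports "HOL-Probability.Probability"
begin

section \<open>Spanning trees\<close>

text \<open>
  Undirected edges are two-element sets of vertices. The session \<open>Graph_Theory\<close> is not used
  here: its \<open>spanning_tree\<close> excludes only directed cycles, which does not give undirected trees.
\<close>

definition complete_edges :: "'v set \<Rightarrow> 'v set set" where
  "complete_edges V = {{p, q} | p q. p \<in> V \<and> q \<in> V \<and> p \<noteq> q}"

definition connected_graph :: "'v set \<Rightarrow> 'v set set \<Rightarrow> bool" where
  "connected_graph V T \<longleftrightarrow> (\<forall>p\<in>V. \<forall>q\<in>V. (p, q) \<in> {(x, y). {x, y} \<in> T}\<^sup>*)"

definition is_cycle :: "'v set set \<Rightarrow> 'v list \<Rightarrow> bool" where
  "is_cycle T xs \<longleftrightarrow> 3 \<le> length xs \<and> distinct xs \<and>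
     (\<forall>i<length xs. {xs ! i, xs ! (Suc i mod length xs)} \<in> T)"

definition acyclic_graph :: "'v set set \<Rightarrow> bool" where
  "acyclic_graph T \<longleftrightarrow> (\<nexists>xs. is_cycle T xs)"

definition spanning_trees :: "'v set \<Rightarrow> 'v set set \<Rightarrow> 'v set set set" where
  "spanning_trees V E = {T. T \<subseteq> E \<and> connected_graph V T \<and> acyclic_graph T}"

text \<open>
  The value at an undirected edge \<open>{p, q}\<close> of an expression \<open>f p q\<close> that is symmetric in its
  two arguments. It is unspecified if \<open>f\<close> is not symmetric.
\<close>

definition on_edge :: "('v \<Rightarrow> 'v \<Rightarrow> 'b) \<Rightarrow> 'v set \<Rightarrow> 'b" where
  "on_edge f e = (THE y. \<exists>p q. e = {p, q} \<and> y = f p q)"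

lemma on_edge_eq:
  assumes "\<And>x y. f x y = f y x"
  shows "on_edge f {p, q} = f p q"
  unfolding on_edge_def using assms by (auto intro!: the_equality simp: doubleton_eq_iff)

definition tree_weight :: "('v \<Rightarrow> 'v \<Rightarrow> real) \<Rightarrow> 'v set set \<Rightarrow> real" where
  "tree_weight w T = (\<Prod>e\<in>T. on_edge w e)"

text \<open>
  \<open>embed_pmf\<close> yields the intended distribution only if the given masses are nonnegative and sum
  to one. Lemma \<open>pmf_random_spanning_tree\<close> below shows that this is so for complete graphs with
  positive symmetric weights.
\<close>

definition random_spanning_tree :: "'v set \<Rightarrow> 'v set set \<Rightarrow> ('v \<Rightarrow> 'v \<Rightarrow> real) \<Rightarrow> 'v set set pmf" where
  "random_spanning_tree V E w = embed_pmf (\<lambda>T. if T \<in> spanning_trees V E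
     then tree_weight w T / (\<Sum>T'\<in>spanning_trees V E. tree_weight w T') else 0)"

section \<open>The Schur clique and the CAST update\<close>

definition edge_laplacian :: "'d::finite \<Rightarrow> 'd \<Rightarrow> real^'d^'d" where
  "edge_laplacian i j = (let x = axis i 1 - axis j 1 in
     (columnvector x :: real^1^'d) ** (rowvector x :: real^'d^1))"

text \<open>The index set \<open>[d]\<close> is rendered as an arbitrary finite linearly ordered type.\<close>

definition schur_clique ::
  "('d::{finite,linorder} \<Rightarrow> real) \<Rightarrow> real^'d::{finite,linorder}^'d::{finite,linorder}" where
  "schur_clique a = (\<Sum>(i, j)\<in>{(i, j). i < j}. (a i * a j / (\<Sum>k\<in>UNIV. a k)) *\<^sub>R edge_laplacian i j)"

definition block :: "nat \<Rightarrow> 'd \<Rightarrow> ('d \<times> nat) set" where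
  "block \<rho> i = {(i, k) | k. k \<in> {1..\<rho>}}"

definition copies :: "nat \<Rightarrow> ('d \<times> nat) set" where
  "copies \<rho> = (\<Union>i. block \<rho> i)"

definition label :: "'d \<times> nat \<Rightarrow> 'd" where
  "label p = fst p"

definition conductance :: "('d \<Rightarrow> real) \<Rightarrow> nat \<Rightarrow> 'd \<times> nat \<Rightarrow> real" where
  "conductance a \<rho> p = a (label p) / real \<rho>"

definition expanded_weight :: "('d::finite \<Rightarrow> real) \<Rightarrow> nat \<Rightarrow> 'd \<times> nat \<Rightarrow> 'd \<times> nat \<Rightarrow> real" where
  "expanded_weight a \<rho> p q = conductance a \<rho> p * conductance a \<rho> q / (\<Sum>i\<in>UNIV. a i)"

definition cast_tree :: "('d::finite \<Rightarrow> real) \<Rightarrow> nat \<Rightarrow> ('d \<times> nat) set set pmf" where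
  "cast_tree a \<rho> =
     random_spanning_tree (copies \<rho>) (complete_edges (copies \<rho>)) (expanded_weight a \<rho>)"

definition cast_update :: "('d::finite \<Rightarrow> real) \<Rightarrow> nat \<Rightarrow> ('d \<times> nat) set set \<Rightarrow> real^'d^'d" where
  "cast_update a \<rho> T = (\<Sum>e\<in>{e\<in>T. on_edge (\<lambda>p q. label p \<noteq> label q) e}.
     on_edge (\<lambda>p q. (conductance a \<rho> p * conductance a \<rho> q / (conductance a \<rho> p + conductance a \<rho> q))
        *\<^sub>R edge_laplacian (label p) (label q)) e)"

section \<open>Well-definedness\<close>

lemma edge_laplacian_nth:
  "edge_laplacian i j $ k $ l =
     ((axis i 1 :: real^'d::finite) - axis j 1) $ k * ((axis i 1 :: real^'d) - axis j 1) $ l"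
  by (simp add: edge_laplacian_def matrix_matrix_mult_def columnvector_def rowvector_def)

lemma edge_laplacian_commute: "edge_laplacian i j = edge_laplacian j i"
  by (simp add: vec_eq_iff edge_laplacian_nth algebra_simps)

lemma cast_update_edge:
  "on_edge (\<lambda>p q. (conductance a \<rho> p * conductance a \<rho> q / (conductance a \<rho> p + conductance a \<rho> q))
     *\<^sub>R edge_laplacian (label p) (label q)) {p, q} =
   (conductance a \<rho> p * conductance a \<rho> q / (conductance a \<rho> p + conductance a \<rho> q))
     *\<^sub>R edge_laplacian (label p) (label q)"
  by (rule on_edge_eq) (simp add: edge_laplacian_commute mult.commute add.commute)

lemma finite_spanning_trees:
  assumes "finite V"
  shows "finite (spanning_trees V (complete_edges V))"
proof (rule finite_subset)
  show "spanning_trees V (complete_edges V) \<subseteq> Pow (Pow V)"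
    by (auto simp: spanning_trees_def complete_edges_def)
qed (use assms in simp)

lemma star_spanning_tree:
  assumes "r \<in> V"
  shows "{{r, q} | q. q \<in> V \<and> q \<noteq> r} \<in> spanning_trees V (complete_edges V)" (is "?T \<in> _")
proof -
  have sub: "?T \<subseteq> complete_edges V" using assms by (auto simp: complete_edges_def)
  let ?R = "{(x, y). {x, y} \<in> ?T}"
  have 1: "(r, q) \<in> ?R\<^sup>*" "(q, r) \<in> ?R\<^sup>*" if "q \<in> V" for q
  proof -
    have "q = r \<or> (r, q) \<in> ?R \<and> (q, r) \<in> ?R" using that by (auto simp: doubleton_eq_iff)
    then show "(r, q) \<in> ?R\<^sup>*" "(q, r) \<in> ?R\<^sup>*" by auto
  qed
  have conn: "connected_graph V ?T"
    unfolding connected_graph_def using 1 by (meson rtrancl_trans)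
  have "\<not> is_cycle ?T xs" for xs
  proof
    assume c: "is_cycle ?T xs"
    define n where "n = length xs"
    have n: "3 \<le> n" and d: "distinct xs"
      and e: "\<And>i. i < n \<Longrightarrow> {xs ! i, xs ! (Suc i mod n)} \<in> ?T"
      using c by (auto simp: is_cycle_def n_def)
    have r: "r \<in> {xs ! i, xs ! (Suc i mod n)}" if "i < n" for i
      using e[OF that] by blast
    have inj: "xs ! i = xs ! j \<longleftrightarrow> i = j" if "i < n" "j < n" for i j
      using nth_eq_iff_index_eq[OF d] that by (simp add: n_def)
    have lt: "0 < n" "1 < n" "2 < n" using n by linarith+
    have s: "Suc 0 mod n = 1" "Suc 1 mod n = 2" "Suc 2 mod n = 3 mod n" using n by simp_all
    have rr: "r = xs ! 0 \<or> r = xs ! 1" "r = xs ! 1 \<or> r = xs ! 2"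
      "r = xs ! 2 \<or> r = xs ! (3 mod n)"
      using r[OF lt(1), unfolded s] r[OF lt(2), unfolded s] r[OF lt(3), unfolded s] by blast+
    have "3 mod n = (if n = 3 then 0 else 3)" using n by auto
    then have m: "3 mod n \<noteq> 1" "3 mod n < n" using n by auto
    have "xs ! 0 \<noteq> xs ! 2" "xs ! 1 \<noteq> xs ! 2" "xs ! 1 \<noteq> xs ! (3 mod n)"
      using inj[OF lt(1,3)] inj[OF lt(2,3)] inj[OF lt(2) m(2)] m(1) by auto
    then show False using rr by metis
  qed
  then show ?thesis using sub conn by (simp add: spanning_trees_def acyclic_graph_def)
qed

lemma pmf_random_spanning_tree:
  assumes "finite V" "V \<noteq> {}"
    and pos: "\<And>p q. p \<in> V \<Longrightarrow> q \<in> V \<Longrightarrow> w p q > 0"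
    and sym: "\<And>p q. w p q = w q p"
  shows "pmf (random_spanning_tree V (complete_edges V) w) T =
    (if T \<in> spanning_trees V (complete_edges V)
     then tree_weight w T / (\<Sum>T'\<in>spanning_trees V (complete_edges V). tree_weight w T') else 0)"
proof -
  let ?S = "spanning_trees V (complete_edges V)"
  define Z where "Z = (\<Sum>T'\<in>?S. tree_weight w T')"
  define f where "f = (\<lambda>T. if T \<in> ?S then tree_weight w T / Z else 0)"
  have fin: "finite ?S" using assms(1) by (rule finite_spanning_trees)
  have tw: "tree_weight w T > 0" if T: "T \<in> ?S" for T
    unfolding tree_weight_def
  proof (rule prod_pos)
    fix e assume "e \<in> T"
    then have "e \<in> complete_edges V" using T by (simp add: spanning_trees_def subset_iff)
    then obtain p q where e: "e = {p, q}" "p \<in> V" "q \<in> V"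
      unfolding complete_edges_def by blast
    have "on_edge w e = w p q" unfolding e(1) using sym by (rule on_edge_eq)
    then show "0 < on_edge w e" using pos[OF e(2,3)] by simp
  qed
  obtain r where "r \<in> V" using assms(2) by blast
  from star_spanning_tree[OF this] have "?S \<noteq> {}" by (metis empty_iff)
  then have Z: "Z > 0" unfolding Z_def by (intro sum_pos fin tw)
  have nn: "f T \<ge> 0" for T using tw[of T] Z by (auto simp: f_def)
  have "(\<integral>\<^sup>+T. ennreal (f T) \<partial>count_space UNIV) = (\<integral>\<^sup>+T. ennreal (f T) \<partial>count_space ?S)"
    by (subst nn_integral_count_space_indicator)
      (auto intro!: nn_integral_cong simp: f_def indicator_def)
  also have "\<dots> = (\<Sum>T\<in>?S. ennreal (f T))" by (rule nn_integral_count_space_finite[OF fin])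
  also have "\<dots> = ennreal (\<Sum>T\<in>?S. f T)" using nn by simp
  also have "(\<Sum>T\<in>?S. f T) = 1"
    using Z by (simp add: f_def sum_divide_distrib[symmetric] Z_def)
  finally have "(\<integral>\<^sup>+T. ennreal (f T) \<partial>count_space UNIV) = 1" by simp
  then have "pmf (embed_pmf f) T = f T" using nn by (intro pmf_embed_pmf) auto
  then show ?thesis unfolding random_spanning_tree_def f_def Z_def .
qed

end

theory Submission
  imports Defs
begin

text \<open>
  The weights \<open>c\<^sub>p c\<^sub>q / a\<close> have product form, and \<open>a\<close> is also the total conductance of all copies. In
  such a complete graph an edge \<open>{p, q}\<close> lies in the random tree with probability
  \<open>(c\<^sub>p + c\<^sub>q) / a\<close>, which cancels the factor \<open>c\<^sub>p c\<^sub>q / (c\<^sub>p + c\<^sub>q)\<close> of the update down to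
  \<open>c\<^sub>p c\<^sub>q / a\<close>; summing over the copies gives \<open>a\<^sub>i a\<^sub>j / a\<close>.

  For the marginal, orient trees towards the root \<open>p\<close>. The weight of a tree is then, up to a
  constant, the product of \<open>c\<close> over the parents of all non-root vertices. Grow a rooted forest by
  giving one root other than \<open>p\<close> a parent in another component. Summed over the choices of the
  parent, the weight of the forest times the weight of the component of \<open>p\<close> is multiplied by
  exactly \<open>a\<close>. Starting from the empty forest gives the total weight of all trees; starting from
  the single arc from \<open>q\<close> to \<open>p\<close> gives the weight of those containing \<open>{p, q}\<close>.
\<close>

section \<open>Rooted forests\<close>

text \<open>Arcs point to parents, and the roots are the vertices outside \<open>U\<close>.\<close>

definition rooted_forests :: "'v set \<Rightarrow> 'v set \<Rightarrow> ('v \<times> 'v) set set" where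
  "rooted_forests V U = {R. Domain R = U \<and> Range R \<subseteq> V \<and> single_valued R \<and> acyclic R}"

text \<open>For edge weights \<open>k * c x * c y\<close> each non-root is a child exactly once.
  With the set of roots fixed, only the factors of the parents vary from forest to forest.\<close>

definition parent_weight :: "('v \<Rightarrow> real) \<Rightarrow> ('v \<times> 'v) set \<Rightarrow> real" where
  "parent_weight c R = (\<Prod>(x, y)\<in>R. c y)"

text \<open>For a root \<open>x\<close>, the vertices that reach \<open>x\<close> are those of its
  component, so this is the weight of that component.\<close>

definition drain_weight :: "'v set \<Rightarrow> ('v \<Rightarrow> real) \<Rightarrow> ('v \<times> 'v) set \<Rightarrow> 'v \<Rightarrow> real" where
  "drain_weight V c R x = (\<Sum>v\<in>{v\<in>V. (v, x) \<in> R\<^sup>*}. c v)"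

section \<open>Finiteness of forests and growth by one arc\<close>

lemma finite_rooted_forest:
  assumes "finite V" "U \<subseteq> V" "R \<in> rooted_forests V U"
  shows "finite R"
proof (rule finite_subset)
  show "R \<subseteq> U \<times> V" using assms(3) by (auto simp: rooted_forests_def)
  show "finite (U \<times> V)" using assms finite_subset by blast
qed

lemma finite_rooted_forests:
  assumes "finite V" "U \<subseteq> V"
  shows "finite (rooted_forests V U)"
proof (rule finite_subset)
  show "rooted_forests V U \<subseteq> Pow (U \<times> V)" by (auto simp: rooted_forests_def)
  show "finite (Pow (U \<times> V))" using assms finite_subset by blast
qed

lemma rooted_forest_insert:
  assumes "R \<in> rooted_forests V U" "z \<notin> U" "y \<in> V" "(y, z) \<notin> R\<^sup>*"
  shows "insert (z, y) R \<in> rooted_forests V (insert z U)"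
  using assms by (auto simp: rooted_forests_def single_valued_def acyclic_insert)

lemma rooted_forest_insert_cases:
  assumes "R \<in> rooted_forests V (insert z U)" "z \<notin> U"
  obtains S y where "S \<in> rooted_forests V U" "y \<in> V" "(y, z) \<notin> S\<^sup>*" "R = insert (z, y) S"
proof -
  obtain y where y: "(z, y) \<in> R" using assms(1) by (auto simp: rooted_forests_def)
  define S where "S = R - {(z, y)}"
  have R: "R = insert (z, y) S" using y by (auto simp: S_def)
  have "acyclic (insert (z, y) S)" using assms(1) R by (simp add: rooted_forests_def)
  then have S: "acyclic S" "(y, z) \<notin> S\<^sup>*" by (auto simp: acyclic_insert)
  have "u = y" if "(z, u) \<in> R" for u
    using that y assms(1) by (auto simp: rooted_forests_def single_valued_def)
  then have "z \<notin> Domain S" by (auto simp: S_def)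
  moreover have "insert z (Domain S) = insert z U"
    using assms(1) by (simp add: rooted_forests_def R)
  ultimately have "Domain S = U" using assms(2) by (simp add: insert_ident)
  moreover have "single_valued S"
    using assms(1) by (auto simp: rooted_forests_def S_def single_valued_def)
  moreover have "Range S \<subseteq> V" "y \<in> V" using assms(1) y by (auto simp: rooted_forests_def S_def)
  ultimately show thesis using that[of S y] S R by (simp add: rooted_forests_def)
qed

text \<open>Each forest in which \<open>z\<close> has a parent arises exactly once, by adding the
  arc out of \<open>z\<close>. Since \<open>z\<close> is not in \<open>Domain R0\<close>, deleting
  that arc does not disturb \<open>R0\<close>.\<close>

lemma sum_rooted_forests_insert:
  assumes V: "finite V" "insert z U \<subseteq> V" "z \<notin> U" and R0: "z \<notin> Domain R0"
  shows "(\<Sum>R\<in>{R\<in>rooted_forests V (insert z U). R0 \<subseteq> R}. g R) =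
    (\<Sum>R\<in>{R\<in>rooted_forests V U. R0 \<subseteq> R}. \<Sum>y\<in>{y\<in>V. (y, z) \<notin> R\<^sup>*}. g (insert (z, y) R))"
proof -
  let ?A = "{R\<in>rooted_forests V U. R0 \<subseteq> R}"
  let ?B = "\<lambda>R. {y\<in>V. (y, z) \<notin> R\<^sup>*}"
  let ?h = "\<lambda>(R, y). insert (z, y) R"
  have z: "(z, y) \<notin> R" if "R \<in> rooted_forests V U" for R y
    using that assms(3) by (auto simp: rooted_forests_def)
  have inj: "inj_on ?h (Sigma ?A ?B)"
  proof (rule inj_onI, clarify)
    fix R y R' y'
    assume *: "R \<in> rooted_forests V U" "R' \<in> rooted_forests V U"
      and eq: "insert (z, y) R = insert (z, y') R'"
    have "y = y'" using eq z[OF *(1)] z[OF *(2)] by blast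
    then show "R = R' \<and> y = y'"
      using eq by (metis insert_ident z[OF *(1)] z[OF *(2)])
  qed
  have img: "?h ` Sigma ?A ?B = {R\<in>rooted_forests V (insert z U). R0 \<subseteq> R}"
  proof (intro equalityI subsetI)
    fix R assume "R \<in> ?h ` Sigma ?A ?B"
    then show "R \<in> {R\<in>rooted_forests V (insert z U). R0 \<subseteq> R}"
      using rooted_forest_insert assms(3) by fastforce
  next
    fix R assume "R \<in> {R\<in>rooted_forests V (insert z U). R0 \<subseteq> R}"
    then have R: "R \<in> rooted_forests V (insert z U)" "R0 \<subseteq> R" by auto
    obtain S y where S: "S \<in> rooted_forests V U" "y \<in> V" "(y, z) \<notin> S\<^sup>*" "R = insert (z, y) S"
      using rooted_forest_insert_cases[OF R(1) assms(3)] .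
    have "R0 \<subseteq> S" using R(2) S(4) R0 by blast
    then show "R \<in> ?h ` Sigma ?A ?B" using S by (intro image_eqI[of _ _ "(S, y)"]) auto
  qed
  have "finite ?A" using finite_rooted_forests[OF V(1)] V(2) by simp
  moreover have "\<forall>R\<in>?A. finite (?B R)" using V(1) by simp
  ultimately show ?thesis
    unfolding img[symmetric] sum.reindex[OF inj]
    by (simp add: sum.Sigma case_prod_unfold comp_def)
qed

section \<open>Weights of components during growth\<close>

lemma parent_weight_insert:
  assumes "finite R" "z \<notin> Domain R"
  shows "parent_weight c (insert (z, y) R) = c y * parent_weight c R"
  using assms by (subst parent_weight_def, subst prod.insert) (auto simp: parent_weight_def)

text \<open>Two paths from \<open>v\<close> in a single-valued relation are comparable, so one of
  the roots would reach the other; but no arc leaves a root.\<close>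

lemma roots_drain_disjoint:
  assumes "single_valued R" "z \<notin> Domain R" "r \<notin> Domain R" "r \<noteq> z"
    and "(v, r) \<in> R\<^sup>*" "(v, z) \<in> R\<^sup>*"
  shows False
proof -
  have "(r, z) \<in> R\<^sup>* \<or> (z, r) \<in> R\<^sup>*"
    using single_valued_confluent assms by metis
  then show False using assms(2-4) by (auto elim: converse_rtranclE)
qed

text \<open>A path through the new arc first reaches \<open>z\<close> and then continues from
  \<open>y\<close>. Hence all that drains to \<open>z\<close> joins the component of
  \<open>r\<close> if \<open>y\<close> lies in it; the two sets are disjoint, so their weights
  add.\<close>

lemma drain_weight_insert:
  assumes "finite V" "single_valued R" "z \<notin> Domain R" "r \<notin> Domain R" "r \<noteq> z"
  shows "drain_weight V c (insert (z, y) R) r =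
    drain_weight V c R r + (if (y, r) \<in> R\<^sup>* then drain_weight V c R z else 0)"
proof -
  let ?D = "\<lambda>x. {v\<in>V. (v, x) \<in> R\<^sup>*}"
  have "?D r \<inter> ?D z = {}" using roots_drain_disjoint[OF assms(2-5)] by blast
  moreover have "{v\<in>V. (v, r) \<in> (insert (z, y) R)\<^sup>*} =
      (if (y, r) \<in> R\<^sup>* then ?D r \<union> ?D z else ?D r)"
    unfolding rtrancl_insert by auto
  ultimately show ?thesis
    using assms(1) by (simp add: drain_weight_def sum.union_disjoint)
qed

text \<open>
  Giving the root \<open>z\<close> a parent \<open>y\<close> in another component either leaves the component of \<open>r\<close>
  unchanged or, if \<open>y\<close> lies in it, enlarges it by that of \<open>z\<close>. With \<open>C\<close> the total weight and
  \<open>A\<close>, \<open>B\<close> the weights of the components of \<open>r\<close> and \<open>z\<close>, this gives \<open>(C - B) A + A B = C A\<close>.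
\<close>

lemma sum_drain_weight_step:
  assumes V: "finite V" and R: "R \<in> rooted_forests V U" and U: "U \<subseteq> V"
    and z: "z \<in> V - U" and r: "r \<in> V - U" and rz: "r \<noteq> z"
  shows "(\<Sum>y\<in>{y\<in>V. (y, z) \<notin> R\<^sup>*}.
      parent_weight c (insert (z, y) R) * drain_weight V c (insert (z, y) R) r) =
    sum c V * (parent_weight c R * drain_weight V c R r)"
proof -
  let ?N = "{y\<in>V. (y, z) \<notin> R\<^sup>*}"
  let ?w = "parent_weight c R" and ?A = "drain_weight V c R r" and ?B = "drain_weight V c R z"
  have dom: "z \<notin> Domain R" "r \<notin> Domain R" "single_valued R"
    using R z r by (auto simp: rooted_forests_def)
  have N: "sum c ?N = sum c V - ?B"
  proof -
    have "?N = V - {v\<in>V. (v, z) \<in> R\<^sup>*}" by auto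
    then show ?thesis using V by (simp add: drain_weight_def sum_diff)
  qed
  have A: "(\<Sum>y\<in>?N. if (y, r) \<in> R\<^sup>* then c y else 0) = ?A"
  proof -
    have "{y\<in>?N. (y, r) \<in> R\<^sup>*} = {v\<in>V. (v, r) \<in> R\<^sup>*}"
      using roots_drain_disjoint[OF dom(3,1,2) rz] by blast
    then show ?thesis using V by (simp add: drain_weight_def flip: sum.inter_filter)
  qed
  have "(\<Sum>y\<in>?N. parent_weight c (insert (z, y) R) * drain_weight V c (insert (z, y) R) r) =
      (\<Sum>y\<in>?N. ?w * ?A * c y + ?w * ?B * (if (y, r) \<in> R\<^sup>* then c y else 0))"
    using finite_rooted_forest[OF V U R] dom V rz
    by (intro sum.cong) (auto simp: parent_weight_insert drain_weight_insert algebra_simps)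
  also have "\<dots> = ?w * ?A * sum c ?N + ?w * ?B * (\<Sum>y\<in>?N. if (y, r) \<in> R\<^sup>* then c y else 0)"
    by (simp add: sum.distrib sum_distrib_left)
  also have "\<dots> = sum c V * (?w * ?A)" unfolding N A by (simp add: algebra_simps)
  finally show ?thesis .
qed

text \<open>Induction on \<open>W\<close>: its vertices receive parents one after the other, and
  each of these steps multiplies the sum by \<open>sum c V\<close>, whatever the order.\<close>

lemma sum_drain_weight:
  assumes V: "finite V" and R0: "R0 \<in> rooted_forests V U" and W: "W \<subseteq> V" "W \<inter> U = {}"
    and U: "U \<subseteq> V" and r: "r \<in> V" "r \<notin> U" "r \<notin> W"
  shows "(\<Sum>R\<in>{R\<in>rooted_forests V (U \<union> W). R0 \<subseteq> R}. parent_weight c R * drain_weight V c R r) =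
    sum c V ^ card W * (parent_weight c R0 * drain_weight V c R0 r)"
proof -
  have "finite W" using W(1) V by (rule finite_subset)
  then show ?thesis using W r
  proof (induction W rule: finite_induct)
    case empty
    \<comment> \<open>Equal domains and single-valuedness leave no room for an arc outside
      \<open>R0\<close>.\<close>
    have "R = R0" if "R \<in> rooted_forests V U" "R0 \<subseteq> R" for R
    proof -
      have "(x, y) \<in> R0" if xy: "(x, y) \<in> R" for x y
      proof -
        have "x \<in> U" using xy \<open>R \<in> _\<close> by (auto simp: rooted_forests_def)
        then obtain u where u: "(x, u) \<in> R0" using R0 by (auto simp: rooted_forests_def)
        then have "u = y"
          using xy \<open>R0 \<subseteq> R\<close> \<open>R \<in> _\<close> by (auto simp: rooted_forests_def single_valued_def)
        then show ?thesis using u by simp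
      qed
      then show ?thesis using \<open>R0 \<subseteq> R\<close> by auto
    qed
    then have eq: "{R\<in>rooted_forests V U. R0 \<subseteq> R} = {R0}" using R0 by blast
    show ?case unfolding Un_empty_right eq by simp
  next
    case (insert z W)
    have U': "insert z (U \<union> W) \<subseteq> V" "z \<notin> U \<union> W" using insert U by auto
    have z: "z \<notin> Domain R0" using R0 insert by (auto simp: rooted_forests_def)
    have "(\<Sum>R\<in>{R\<in>rooted_forests V (insert z (U \<union> W)). R0 \<subseteq> R}.
        parent_weight c R * drain_weight V c R r) =
      (\<Sum>R\<in>{R\<in>rooted_forests V (U \<union> W). R0 \<subseteq> R}.
        sum c V * (parent_weight c R * drain_weight V c R r))"
      unfolding sum_rooted_forests_insert[OF V U' z]
      using insert.prems U U'
      by (intro sum.cong refl sum_drain_weight_step[OF V, where U = "U \<union> W"]) auto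
    also have "\<dots> = sum c V * (sum c V ^ card W * (parent_weight c R0 * drain_weight V c R0 r))"
      using insert by (simp flip: sum_distrib_left)
    finally show ?case using insert.hyps by simp
  qed
qed

section \<open>Trees with a single root\<close>

text \<open>Passing to parents terminates, since a finite acyclic relation has a well-founded
  converse, and it can only stop at \<open>r\<close>.\<close>

lemma in_tree_reaches_root:
  assumes V: "finite V" "r \<in> V" and R: "R \<in> rooted_forests V (V - {r})" and "v \<in> V"
  shows "(v, r) \<in> R\<^sup>*"
proof -
  have "finite R" using finite_rooted_forest[OF V(1) _ R] by blast
  then have "wf (R\<inverse>)" using R by (intro finite_acyclic_wf_converse) (auto simp: rooted_forests_def)
  then show ?thesis using \<open>v \<in> V\<close>
  proof (induction v rule: wf_induct_rule)
    case (less v)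
    show ?case
    proof (cases "v = r")
      case False
      then obtain u where u: "(v, u) \<in> R" using R less.prems by (auto simp: rooted_forests_def)
      then have "(u, r) \<in> R\<^sup>*" using less.IH R by (auto simp: rooted_forests_def)
      then show ?thesis using u by (rule converse_rtrancl_into_rtrancl[rotated])
    qed simp
  qed
qed

text \<open>Once \<open>r\<close> is the only root, everything drains to it and its drain weight is
  the constant \<open>sum c V\<close>. Keeping this factor on the left avoids a division.\<close>

lemma sum_in_trees:
  assumes V: "finite V" and R0: "R0 \<in> rooted_forests V U" and U: "U \<subseteq> V" and r: "r \<in> V" "r \<notin> U"
  shows "sum c V * (\<Sum>R\<in>{R\<in>rooted_forests V (V - {r}). R0 \<subseteq> R}. parent_weight c R) =
    sum c V ^ card (V - {r} - U) * (parent_weight c R0 * drain_weight V c R0 r)"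
proof -
  have eq: "U \<union> (V - {r} - U) = V - {r}" using U r by auto
  have "drain_weight V c R r = sum c V" if R: "R \<in> rooted_forests V (V - {r})" for R
  proof -
    have "{v\<in>V. (v, r) \<in> R\<^sup>*} = V" using in_tree_reaches_root[OF V r(1) R] by blast
    then show ?thesis by (simp add: drain_weight_def)
  qed
  then have "sum c V * (\<Sum>R\<in>{R\<in>rooted_forests V (V - {r}). R0 \<subseteq> R}. parent_weight c R) =
    (\<Sum>R\<in>{R\<in>rooted_forests V (V - {r}). R0 \<subseteq> R}. parent_weight c R * drain_weight V c R r)"
    by (simp add: sum_distrib_left mult.commute)
  also have "\<dots> = sum c V ^ card (V - {r} - U) * (parent_weight c R0 * drain_weight V c R0 r)"
    using sum_drain_weight[OF V R0 _ _ U, of "V - {r} - U" r c] r unfolding eq by auto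
  finally show ?thesis .
qed

text \<open>The growth process is compared for two starts, \<open>{}\<close> and
  \<open>{(q, p)}\<close>. Their products of parent weight and drain weight at \<open>p\<close> are
  \<open>c p\<close> and \<open>c p * (c p + c q)\<close>, and the second start has one vertex fewer
  to attach.\<close>

lemma in_tree_edge_marginal:
  assumes V: "finite V" "p \<in> V" "q \<in> V" "p \<noteq> q" and C: "sum c V \<noteq> 0"
  shows "sum c V * (\<Sum>R\<in>{R\<in>rooted_forests V (V - {p}). (q, p) \<in> R}. parent_weight c R) =
    (c p + c q) * (\<Sum>R\<in>rooted_forests V (V - {p}). parent_weight c R)"
proof -
  have empty: "{} \<in> rooted_forests V {}" by (auto simp: rooted_forests_def acyclic_def)
  have "drain_weight V c {} p = c p"
  proof -
    have "{v\<in>V. (v, p) \<in> {}\<^sup>*} = {p}" using V by auto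
    then show ?thesis by (simp add: drain_weight_def)
  qed
  then have all: "sum c V * (\<Sum>R\<in>rooted_forests V (V - {p}). parent_weight c R) =
      sum c V ^ card (V - {p}) * c p"
    using sum_in_trees[OF V(1) empty, of p c] V by (simp add: parent_weight_def)
  have "{(q, p)} \<in> rooted_forests V {q}"
    using rooted_forest_insert[OF empty, of q p] V by simp
  moreover have "drain_weight V c {(q, p)} p = c p + c q"
  proof -
    have "{v\<in>V. (v, p) \<in> {(q, p)}\<^sup>*} = {p, q}" using V by (auto elim: rtranclE)
    then show ?thesis using V by (simp add: drain_weight_def)
  qed
  ultimately have edge: "sum c V *
        (\<Sum>R\<in>{R\<in>rooted_forests V (V - {p}). (q, p) \<in> R}. parent_weight c R) =
      sum c V ^ card (V - {p} - {q}) * (c p * (c p + c q))"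
    using sum_in_trees[OF V(1), of "{(q, p)}" "{q}" p c] V by (simp add: parent_weight_def)
  have "Suc (card (V - {p} - {q})) = card (V - {p})" using V by (intro card_Suc_Diff1) auto
  then have "sum c V ^ card (V - {p}) = sum c V * sum c V ^ card (V - {p} - {q})"
    by (metis power_Suc)
  \<comment> \<open>The additional factor \<open>sum c V\<close> makes up for the smaller exponent
    in \<open>edge\<close>; it cancels because the total weight is nonzero.\<close>
  then have "sum c V * (sum c V *
        (\<Sum>R\<in>{R\<in>rooted_forests V (V - {p}). (q, p) \<in> R}. parent_weight c R)) =
      sum c V * ((c p + c q) * (\<Sum>R\<in>rooted_forests V (V - {p}). parent_weight c R))"
    unfolding edge mult.left_commute[of "sum c V" "c p + c q"] all by simp
  then show ?thesis using C by simp
qed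

section \<open>Orientation of spanning trees towards a root\<close>

definition undirect :: "('v \<times> 'v) set \<Rightarrow> 'v set set" where
  "undirect R = (\<lambda>(x, y). {x, y}) ` R"

lemma undirect_iff: "{x, y} \<in> undirect R \<longleftrightarrow> (x, y) \<in> R \<or> (y, x) \<in> R"
  by (force simp: undirect_def doubleton_eq_iff)

lemma acyclic_asym: "acyclic R \<Longrightarrow> (x, y) \<in> R \<Longrightarrow> (y, x) \<notin> R"
  unfolding acyclic_def by (meson r_into_trancl trancl_trans)

text \<open>On an undirected cycle some vertex has no incoming arc from the cycle, by
  well-foundedness. Both cycle edges at it are then outgoing arcs, against
  single-valuedness.\<close>

lemma acyclic_graph_undirect:
  assumes "finite R" "acyclic R" "single_valued R"
  shows "acyclic_graph (undirect R)"
  unfolding acyclic_graph_def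
proof
  assume "\<exists>xs. is_cycle (undirect R) xs"
  then obtain xs where c: "is_cycle (undirect R) xs" ..
  define n where "n = length xs"
  have n: "3 \<le> n" and d: "distinct xs"
    and e: "\<And>i. i < n \<Longrightarrow> {xs ! i, xs ! (Suc i mod n)} \<in> undirect R"
    using c by (auto simp: is_cycle_def n_def)
  have "wf R" using assms by (simp add: finite_acyclic_wf)
  moreover have "xs \<noteq> []" using n by (auto simp: n_def)
  ultimately obtain x where x: "x \<in> set xs" "\<And>y. (y, x) \<in> R \<Longrightarrow> y \<notin> set xs"
    by (metis wfE_min hd_in_set)
  obtain i where i: "i < n" "xs ! i = x" using x(1) by (auto simp: in_set_conv_nth n_def)
  \<comment> \<open>\<open>j\<close> and \<open>s\<close> are the positions cyclically before and
    after \<open>i\<close>; they differ because the cycle has at least three vertices.\<close>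
  define j where "j = (if i = 0 then n - 1 else i - 1)"
  define s where "s = Suc i mod n"
  have j: "j < n" "Suc j mod n = i" using i n by (auto simp: j_def)
  have s: "s < n" using n by (simp add: s_def)
  have "s \<noteq> j"
  proof (cases "Suc i = n")
    case True
    then show ?thesis using n by (auto simp: s_def j_def)
  next
    case False
    then have "s = Suc i" using i by (simp add: s_def)
    then show ?thesis using n by (auto simp: j_def)
  qed
  have "{x, xs ! s} \<in> undirect R" "{xs ! j, x} \<in> undirect R"
    using e[OF i(1)] e[OF j(1)] i j by (simp_all add: s_def)
  moreover have "xs ! s \<in> set xs" "xs ! j \<in> set xs" using s j by (simp_all add: n_def)
  ultimately have "(x, xs ! s) \<in> R" "(x, xs ! j) \<in> R" using x(2) by (auto simp: undirect_iff)
  then have "xs ! s = xs ! j" using assms(3) by (auto simp: single_valued_def)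
  then show False
    using \<open>s \<noteq> j\<close> nth_eq_iff_index_eq[OF d] s j by (simp add: n_def)
qed

lemma connected_graph_undirect:
  assumes "finite V" "r \<in> V" "R \<in> rooted_forests V (V - {r})"
  shows "connected_graph V (undirect R)"
  unfolding connected_graph_def
proof (intro ballI)
  fix p q assume pq: "p \<in> V" "q \<in> V"
  let ?E = "{(x, y). {x, y} \<in> undirect R}"
  have "R \<subseteq> ?E" by (auto simp: undirect_iff)
  then have reach: "(v, r) \<in> ?E\<^sup>*" if "v \<in> V" for v
    using in_tree_reaches_root[OF assms that] rtrancl_mono by blast
  have "sym ?E" by (simp add: sym_def insert_commute)
  then show "(p, q) \<in> ?E\<^sup>*"
    using reach[OF pq(1)] reach[OF pq(2)] by (meson rtrancl_trans sym_rtrancl symD)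
qed

lemma undirect_spanning_tree:
  assumes "finite V" "r \<in> V" and R: "R \<in> rooted_forests V (V - {r})"
  shows "undirect R \<in> spanning_trees V (complete_edges V)"
proof -
  have "undirect R \<subseteq> complete_edges V"
  proof
    fix e assume "e \<in> undirect R"
    then obtain x y where e: "e = {x, y}" "(x, y) \<in> R" by (auto simp: undirect_def)
    have "(y, x) \<notin> R" using e R by (intro acyclic_asym) (simp_all add: rooted_forests_def)
    then have "x \<noteq> y" using e(2) by auto
    moreover have "x \<in> V" "y \<in> V" using e R by (auto simp: rooted_forests_def)
    ultimately show "e \<in> complete_edges V" using e by (auto simp: complete_edges_def)
  qed
  moreover have "finite R" using finite_rooted_forest[OF assms(1) _ R] by blast
  ultimately show ?thesis
    using connected_graph_undirect[OF assms] acyclic_graph_undirect R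
    by (auto simp: spanning_trees_def rooted_forests_def)
qed

text \<open>Induction from the root outwards, so that the arc out of the parent \<open>u\<close> of
  \<open>v\<close> is already known to be in \<open>S\<close>. If \<open>S\<close> reversed the arc
  from \<open>v\<close> to \<open>u\<close>, then \<open>v\<close> would be the parent of
  \<open>u\<close> in \<open>S\<close>, hence also in \<open>R\<close>, giving a 2-cycle.\<close>

lemma undirect_subset_imp_subset:
  assumes V: "finite V" and R: "R \<in> rooted_forests V (V - {r})"
    and S: "S \<in> rooted_forests V (V - {r})" and sub: "undirect R \<subseteq> undirect S"
  shows "R \<subseteq> S"
proof -
  have "finite R" using finite_rooted_forest[OF V _ R] by blast
  then have wf: "wf (R\<inverse>)" using R by (intro finite_acyclic_wf_converse) (auto simp: rooted_forests_def)
  have "\<forall>u. (v, u) \<in> R \<longrightarrow> (v, u) \<in> S" for v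
  proof (induction v rule: wf_induct_rule[OF wf])
    case (1 v)
    show ?case
    proof (intro allI impI, rule ccontr)
      fix u assume vu: "(v, u) \<in> R" "(v, u) \<notin> S"
      have "{v, u} \<in> undirect R" using vu(1) by (simp add: undirect_iff)
      then have "{v, u} \<in> undirect S" using sub by (rule subsetD[rotated])
      then have "(u, v) \<in> S" using vu(2) by (simp add: undirect_iff)
      then have "u \<in> Domain S" by (rule DomainI)
      then have "u \<in> Domain R" using R S by (simp add: rooted_forests_def)
      then obtain t where t: "(u, t) \<in> R" by auto
      have "(u, t) \<in> S" using 1[of u] vu(1) t by simp
      moreover have "single_valued S" using S by (simp add: rooted_forests_def)
      ultimately have "t = v" using \<open>(u, v) \<in> S\<close> single_valuedD by metis
      moreover have "(u, v) \<notin> R"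
        using vu(1) R by (intro acyclic_asym) (simp_all add: rooted_forests_def)
      ultimately show False using t by simp
    qed
  qed
  then show ?thesis by (intro subrelI) blast
qed

section \<open>Simple paths, cycles and in-trees inside connected graphs\<close>

lemma rtrancl_simple_path:
  assumes "(x, y) \<in> E\<^sup>*"
  shows "\<exists>xs. distinct xs \<and> xs \<noteq> [] \<and> hd xs = x \<and> last xs = y \<and> successively (\<lambda>u v. (u, v) \<in> E) xs"
  using assms
proof (induction rule: converse_rtrancl_induct)
  case base
  show ?case by (intro exI[of _ "[y]"]) simp
next
  case (step x z)
  then obtain xs where xs: "distinct xs" "xs \<noteq> []" "hd xs = z" "last xs = y"
    "successively (\<lambda>u v. (u, v) \<in> E) xs" by blast
  show ?case
  proof (cases "x \<in> set xs")
    case True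
    \<comment> \<open>Dropping the prefix \<open>ys\<close> cuts out the loop through
      \<open>x\<close>.\<close>
    then obtain ys zs where "xs = ys @ x # zs" by (auto simp: in_set_conv_decomp)
    then show ?thesis
      using xs by (intro exI[of _ "x # zs"]) (auto simp: successively_append_iff)
  next
    case False
    then show ?thesis
      using xs step.hyps(1) by (intro exI[of _ "x # xs"]) (auto simp: successively_Cons)
  qed
qed

lemma closing_edge_not_acyclic:
  assumes path: "(x, y) \<in> {(u, v). {u, v} \<in> S}\<^sup>*" and "S \<subseteq> T"
    and e: "{x, y} \<in> T" "{x, y} \<notin> S" "x \<noteq> y"
  shows "\<not> acyclic_graph T"
proof -
  obtain xs where xs: "distinct xs" "xs \<noteq> []" "hd xs = x" "last xs = y"
    "successively (\<lambda>u v. (u, v) \<in> {(u, v). {u, v} \<in> S}) xs"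
    using rtrancl_simple_path[OF path] by blast
  define n where "n = length xs"
  have step: "{xs ! i, xs ! Suc i} \<in> S" if "Suc i < n" for i
    using xs(5) that by (auto simp: successively_conv_nth n_def)
  have ends: "xs ! 0 = x" "xs ! (n - 1) = y"
    using xs by (auto simp: hd_conv_nth last_conv_nth n_def)
  \<comment> \<open>One vertex would give \<open>x = y\<close>, and two would put
    \<open>{x, y}\<close> into \<open>S\<close>.\<close>
  have "n \<noteq> 0" "n \<noteq> 1" "n \<noteq> 2" using xs(2) ends e step[of 0] by (auto simp: n_def)
  then have n: "3 \<le> n" by linarith
  have "{xs ! i, xs ! (Suc i mod n)} \<in> T" if "i < n" for i
  proof (cases "Suc i = n")
    case True
    then show ?thesis using ends e(1) by (auto simp: insert_commute)
  next
    case False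
    then have "Suc i < n" using that by simp
    then show ?thesis using step \<open>S \<subseteq> T\<close> by auto
  qed
  then have "is_cycle T xs" using n xs(1) by (simp add: is_cycle_def n_def)
  then show ?thesis by (auto simp: acyclic_graph_def)
qed

lemma rtrancl_crossing:
  assumes "(x, y) \<in> E\<^sup>*" "x \<in> W" "y \<notin> W"
  obtains u v where "(u, v) \<in> E" "u \<in> W" "v \<notin> W"
  using assms by (induction rule: rtrancl_induct) auto

text \<open>Growth as in Prim's algorithm: while the in-tree on \<open>insert r U\<close> misses a
  vertex, connectedness yields an edge of \<open>T\<close> leaving it, and its outer end takes the
  inner end as parent.\<close>

lemma connected_graph_contains_in_tree:
  assumes V: "finite V" "r \<in> V" and T: "T \<subseteq> complete_edges V" "connected_graph V T"
  shows "\<exists>R\<in>rooted_forests V (V - {r}). undirect R \<subseteq> T"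
proof -
  have "k \<le> card (V - {r}) \<Longrightarrow>
    \<exists>U R. U \<subseteq> V - {r} \<and> card U = k \<and> R \<in> rooted_forests (insert r U) U \<and> undirect R \<subseteq> T" for k
  proof (induction k)
    case 0
    show ?case
      by (intro exI[of _ "{}"]) (auto simp: rooted_forests_def acyclic_def undirect_def)
  next
    case (Suc k)
    then obtain U R where U: "U \<subseteq> V - {r}" "card U = k"
      and R: "R \<in> rooted_forests (insert r U) U" "undirect R \<subseteq> T" by auto
    have "finite U" using U(1) V(1) by (meson finite_Diff finite_subset)
    have "U \<noteq> V - {r}" using U(2) Suc.prems by auto
    then obtain v where v: "v \<in> V" "v \<notin> insert r U" using U(1) by blast
    have "(r, v) \<in> {(x, y). {x, y} \<in> T}\<^sup>*"
      using T(2) V(2) v(1) by (auto simp: connected_graph_def)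
    then obtain x y where xy: "{x, y} \<in> T" "x \<in> insert r U" "y \<notin> insert r U"
      by (rule rtrancl_crossing[where W = "insert r U"]) (use v in auto)
    have "y \<in> V" using xy(1) T(1) by (auto simp: complete_edges_def doubleton_eq_iff)
    have "R \<in> rooted_forests (insert r (insert y U)) U"
      using R(1) by (auto simp: rooted_forests_def)
    \<comment> \<open>No arc of \<open>R\<close> enters the new vertex \<open>y\<close>, so the arc
      from \<open>y\<close> to \<open>x\<close> closes no cycle.\<close>
    moreover have "(x, y) \<notin> R\<^sup>*"
    proof
      assume "(x, y) \<in> R\<^sup>*"
      then show False using xy(2,3) R(1) by (cases rule: rtranclE) (auto simp: rooted_forests_def)
    qed
    ultimately have "insert (y, x) R \<in> rooted_forests (insert r (insert y U)) (insert y U)"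
      using xy by (intro rooted_forest_insert) auto
    moreover have "undirect (insert (y, x) R) \<subseteq> T"
      using R(2) xy(1) by (simp add: undirect_def insert_commute)
    moreover have "card (insert y U) = Suc k" using U(2) \<open>finite U\<close> xy(3) by simp
    moreover have "insert y U \<subseteq> V - {r}" using U(1) \<open>y \<in> V\<close> xy(3) by auto
    ultimately show ?case by blast
  qed
  then obtain U R where U: "U \<subseteq> V - {r}" "card U = card (V - {r})"
    and R: "R \<in> rooted_forests (insert r U) U" "undirect R \<subseteq> T" by blast
  have "U = V - {r}" using U V(1) by (intro card_subset_eq) auto
  then show ?thesis using R V(2) by (auto simp: insert_absorb)
qed

text \<open>Injectivity is the inclusion lemma used in both directions. For surjectivity,
  \<open>T\<close> contains an undirected in-tree that already connects \<open>V\<close>, so any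
  further edge of \<open>T\<close> would close a cycle.\<close>

lemma bij_betw_undirect:
  assumes V: "finite V" "r \<in> V"
  shows "bij_betw undirect (rooted_forests V (V - {r})) (spanning_trees V (complete_edges V))"
proof (rule bij_betw_imageI)
  show "inj_on undirect (rooted_forests V (V - {r}))"
    using undirect_subset_imp_subset[OF V(1)] by (intro inj_onI) (metis order_refl subset_antisym)
  show "undirect ` rooted_forests V (V - {r}) = spanning_trees V (complete_edges V)"
  proof (intro equalityI subsetI)
    fix T assume "T \<in> undirect ` rooted_forests V (V - {r})"
    then show "T \<in> spanning_trees V (complete_edges V)" using undirect_spanning_tree[OF V] by auto
  next
    fix T assume "T \<in> spanning_trees V (complete_edges V)"
    then have T: "T \<subseteq> complete_edges V" "connected_graph V T" "acyclic_graph T"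
      by (auto simp: spanning_trees_def)
    obtain R where R: "R \<in> rooted_forests V (V - {r})" "undirect R \<subseteq> T"
      using connected_graph_contains_in_tree[OF V T(1,2)] by blast
    have "T \<subseteq> undirect R"
    proof (rule ccontr)
      assume "\<not> T \<subseteq> undirect R"
      then obtain e where e: "e \<in> T" "e \<notin> undirect R" by blast
      then obtain x y where xy: "e = {x, y}" "x \<in> V" "y \<in> V" "x \<noteq> y"
        using T(1) by (auto simp: complete_edges_def)
      have "(x, y) \<in> {(u, v). {u, v} \<in> undirect R}\<^sup>*"
        using connected_graph_undirect[OF V R(1)] xy by (auto simp: connected_graph_def)
      then show False using closing_edge_not_acyclic R(2) e xy T(3) by metis
    qed
    then show "T \<in> undirect ` rooted_forests V (V - {r})" using R by auto
  qed
qed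

section \<open>Edge marginals of random spanning trees with product weights\<close>

text \<open>The edge weight splits into a child factor \<open>k * c x\<close> and a parent factor
  \<open>c y\<close>. Every vertex of \<open>U\<close> is a child once, so the child factors
  multiply to a constant.\<close>

lemma tree_weight_undirect:
  assumes V: "finite V" "U \<subseteq> V" and R: "R \<in> rooted_forests V U"
    and w: "\<And>x y. w x y = k * c x * c y"
  shows "tree_weight w (undirect R) = (\<Prod>x\<in>U. k * c x) * parent_weight c R"
proof -
  have inj: "inj_on (\<lambda>(x, y). {x, y}) R"
    using R acyclic_asym[of R] by (fastforce simp: inj_on_def rooted_forests_def doubleton_eq_iff)
  have "on_edge w {x, y} = k * c x * c y" for x y
    using on_edge_eq[of w x y] w by (simp add: mult.commute)
  then have "tree_weight w (undirect R) = (\<Prod>(x, y)\<in>R. k * c x * c y)"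
    unfolding tree_weight_def undirect_def prod.reindex[OF inj] by (simp add: case_prod_unfold)
  also have "\<dots> = (\<Prod>z\<in>R. k * c (fst z)) * parent_weight c R"
    by (simp add: parent_weight_def case_prod_unfold prod.distrib)
  also have "(\<Prod>z\<in>R. k * c (fst z)) = (\<Prod>x\<in>fst ` R. k * c x)"
    using R by (subst prod.reindex) (auto simp: inj_on_def rooted_forests_def single_valued_def)
  also have "fst ` R = U" using R by (auto simp: rooted_forests_def Domain_fst)
  finally show ?thesis .
qed

text \<open>For positive weights this says that \<open>{p, q}\<close> is in the tree with
  probability \<open>(c p + c q) / sum c V\<close>. Rooting at \<open>p\<close> reduces it to
  in-trees, and the constant of the child factors occurs on both sides.\<close>

lemma spanning_tree_edge_marginal:
  assumes V: "finite V" "p \<in> V" "q \<in> V" "p \<noteq> q" and C: "sum c V \<noteq> 0"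
    and w: "\<And>x y. w x y = k * c x * c y"
  shows "sum c V * (\<Sum>T\<in>{T\<in>spanning_trees V (complete_edges V). {p, q} \<in> T}. tree_weight w T) =
    (c p + c q) * (\<Sum>T\<in>spanning_trees V (complete_edges V). tree_weight w T)"
proof -
  let ?F = "rooted_forests V (V - {p})" and ?S = "spanning_trees V (complete_edges V)"
  let ?K = "\<Prod>x\<in>V - {p}. k * c x"
  note bij = bij_betw_undirect[OF V(1,2)]
  have K: "tree_weight w (undirect R) = ?K * parent_weight c R" if "R \<in> ?F" for R
    using tree_weight_undirect[where w = w, OF V(1) _ that w] by blast
  have all: "(\<Sum>T\<in>?S. tree_weight w T) = ?K * (\<Sum>R\<in>?F. parent_weight c R)"
    by (simp add: sum.reindex_bij_betw[OF bij, symmetric] K sum_distrib_left)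
  \<comment> \<open>No arc leaves the root \<open>p\<close>, so the edge can only be oriented
    towards it.\<close>
  have "{p, q} \<in> undirect R \<longleftrightarrow> (q, p) \<in> R" if "R \<in> ?F" for R
    using that by (auto simp: undirect_iff rooted_forests_def)
  then have "undirect ` {R\<in>?F. (q, p) \<in> R} = {T\<in>undirect ` ?F. {p, q} \<in> T}" by blast
  then have "bij_betw undirect {R\<in>?F. (q, p) \<in> R} {T\<in>?S. {p, q} \<in> T}"
    using bij by (auto simp: bij_betw_def intro: inj_on_subset)
  then have edge: "(\<Sum>T\<in>{T\<in>?S. {p, q} \<in> T}. tree_weight w T) =
      ?K * (\<Sum>R\<in>{R\<in>?F. (q, p) \<in> R}. parent_weight c R)"
    by (simp add: sum.reindex_bij_betw[symmetric] K sum_distrib_left)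
  show ?thesis
    unfolding all edge mult.left_commute[of _ ?K] in_tree_edge_marginal[OF V C] ..
qed

section \<open>Expectation of the CAST update\<close>

lemma copies_Times: "copies \<rho> = UNIV \<times> {1..\<rho>}"
  by (auto simp: copies_def block_def)

lemma sum_conductance:
  fixes a :: "'d::finite \<Rightarrow> real"
  assumes "\<rho> \<ge> 1"
  shows "sum (conductance a \<rho>) (copies \<rho>) = sum a UNIV"
proof -
  have "(\<Sum>i\<in>UNIV. \<Sum>k\<in>{1..\<rho>}. conductance a \<rho> (i, k)) = sum (conductance a \<rho>) (copies \<rho>)"
    by (simp add: copies_Times sum.cartesian_product del: sum_constant)
  then show ?thesis using assms by (simp add: conductance_def label_def)
qed

text \<open>Listing the smaller label first turns the sum over undirected edges into one over
  ordered pairs, each crossing edge being met once.\<close>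

lemma crossing_edges:
  fixes V :: "('d::linorder \<times> nat) set"
  shows "{e\<in>complete_edges V. on_edge (\<lambda>p q. label p \<noteq> label q) e} =
    (\<lambda>(p, q). {p, q}) ` {(p, q). p \<in> V \<and> q \<in> V \<and> label p < label q}" (is "?L = ?f ` ?D")
proof -
  have iff: "on_edge (\<lambda>p q. label p \<noteq> label q) {p, q} \<longleftrightarrow> label p \<noteq> label q"
    for p q :: "'d \<times> nat"
    by (rule on_edge_eq) auto
  show ?thesis
  proof (intro equalityI subsetI)
    fix e assume "e \<in> ?L"
    then obtain p q where e: "e = {p, q}" "p \<in> V" "q \<in> V" "label p \<noteq> label q"
      unfolding complete_edges_def using iff by auto
    then have "e = ?f (p, q) \<and> (p, q) \<in> ?D \<or> e = ?f (q, p) \<and> (q, p) \<in> ?D" by auto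
    then show "e \<in> ?f ` ?D" by blast
  next
    fix e assume "e \<in> ?f ` ?D"
    then obtain p q where e: "e = {p, q}" "p \<in> V" "q \<in> V" "label p < label q" by auto
    then have "label p \<noteq> label q" "p \<noteq> q" by auto
    then show "e \<in> ?L" unfolding complete_edges_def using e iff[of p q] by blast
  qed
qed

text \<open>By linearity only the probability of each single edge matters; no joint law of the edges
  enters.\<close>

lemma expectation_cast_update:
  fixes a :: "'d::{finite,linorder} \<Rightarrow> real"
  assumes a: "\<And>i. a i > 0" and \<rho>: "\<rho> \<ge> 1"
  shows "measure_pmf.expectation (cast_tree a \<rho>) (cast_update a \<rho>) =
    (\<Sum>(p, q)\<in>{(p, q). p \<in> copies \<rho> \<and> q \<in> copies \<rho> \<and> label p < label q}.
      expanded_weight a \<rho> p q *\<^sub>R edge_laplacian (label p) (label q))"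
proof -
  let ?V = "copies \<rho> :: ('d \<times> nat) set" and ?c = "conductance a \<rho>"
  let ?w = "expanded_weight a \<rho>"
  let ?S = "spanning_trees ?V (complete_edges ?V)"
  let ?Z = "\<Sum>T\<in>?S. tree_weight ?w T"
  let ?P = "\<lambda>e. \<Sum>T\<in>{T\<in>?S. e \<in> T}. tree_weight ?w T / ?Z"
  let ?E = "{e\<in>complete_edges ?V. on_edge (\<lambda>p q. label p \<noteq> label q) e}"
  let ?D = "{(p, q). p \<in> ?V \<and> q \<in> ?V \<and> label p < label q}"
  let ?g = "on_edge (\<lambda>p q. (?c p * ?c q / (?c p + ?c q)) *\<^sub>R edge_laplacian (label p) (label q))"
  have V: "finite ?V" "?V \<noteq> {}" using \<rho> by (auto simp: copies_Times)
  have fin: "finite ?S" using V(1) by (rule finite_spanning_trees)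
  have A: "sum a UNIV > 0" using a by (intro sum_pos) auto
  have c: "?c p > 0" for p using a \<rho> by (simp add: conductance_def)
  have w: "?w p q > 0" "?w p q = ?w q p" "?w p q = 1 / sum a UNIV * ?c p * ?c q" for p q
    using c[of p] c[of q] A by (simp_all add: expanded_weight_def mult.commute)
  note pmf = pmf_random_spanning_tree[where w = ?w, OF V w(1,2)]
  obtain r where "r \<in> ?V" using V(2) by blast
  from star_spanning_tree[OF this] obtain T0 where "T0 \<in> ?S" by blast
  have tw: "tree_weight ?w T > 0" if T: "T \<in> ?S" for T
    unfolding tree_weight_def
  proof (rule prod_pos)
    fix e assume "e \<in> T"
    then obtain p q where "e = {p, q}"
      using T by (auto simp: spanning_trees_def complete_edges_def)
    then show "0 < on_edge ?w e" using on_edge_eq[of ?w p q] w(1,2) by metis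
  qed
  have Z: "?Z > 0" using fin \<open>T0 \<in> ?S\<close> tw by (intro sum_pos) auto
  \<comment> \<open>The sum over edges of \<open>T\<close> is moved to the fixed index set
    \<open>?E\<close>, so that it can be swapped with the sum over trees.\<close>
  have upd: "cast_update a \<rho> T = (\<Sum>e\<in>?E. if e \<in> T then ?g e else 0)" if "T \<in> ?S" for T
  proof -
    have "finite ?E"
      using V(1) by (intro finite_subset[of ?E "Pow ?V"]) (auto simp: complete_edges_def)
    moreover have "{e\<in>T. on_edge (\<lambda>p q. label p \<noteq> label q) e} = {e\<in>?E. e \<in> T}"
      using that by (auto simp: spanning_trees_def)
    ultimately show ?thesis unfolding cast_update_def by (simp only: sum.inter_filter)
  qed
  have "measure_pmf.expectation (cast_tree a \<rho>) (cast_update a \<rho>) =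
      (\<Sum>T\<in>?S. pmf (cast_tree a \<rho>) T *\<^sub>R cast_update a \<rho> T)"
    using pmf by (intro integral_measure_pmf[OF fin])
      (auto simp: cast_tree_def set_pmf_eq split: if_splits)
  also have "\<dots> = (\<Sum>T\<in>?S. \<Sum>e\<in>?E. (if e \<in> T then tree_weight ?w T / ?Z else 0) *\<^sub>R ?g e)"
    unfolding cast_tree_def pmf
    by (intro sum.cong refl) (auto simp: upd scaleR_sum_right intro!: sum.cong)
  also have "\<dots> = (\<Sum>e\<in>?E. ?P e *\<^sub>R ?g e)"
    by (subst sum.swap) (simp add: fin sum.inter_filter flip: scaleR_sum_left)
  also have "\<dots> = (\<Sum>(p, q)\<in>?D. ?P {p, q} *\<^sub>R ?g {p, q})"
  proof -
    have "inj_on (\<lambda>(p, q). {p, q}) ?D" by (auto simp: inj_on_def doubleton_eq_iff)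
    then show ?thesis
      unfolding crossing_edges by (subst sum.reindex) (simp_all add: case_prod_unfold)
  qed
  also have "\<dots> = (\<Sum>(p, q)\<in>?D. ?w p q *\<^sub>R edge_laplacian (label p) (label q))"
  proof (intro sum.cong refl, clarify)
    fix i k j l assume *: "(i, k) \<in> ?V" "(j, l) \<in> ?V" "label (i, k) < label (j, l)"
    define p q where pq: "p = (i, k)" "q = (j, l)"
    have "p \<noteq> q" using * pq by auto
    moreover have "sum ?c ?V \<noteq> 0" using A \<rho> by (simp add: sum_conductance)
    ultimately have "sum ?c ?V * (\<Sum>T\<in>{T\<in>?S. {p, q} \<in> T}. tree_weight ?w T) = (?c p + ?c q) * ?Z"
      using * pq by (intro spanning_tree_edge_marginal[OF V(1) _ _ _ _ w(3)]) auto
    then have "?P {p, q} = (?c p + ?c q) / sum a UNIV"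
      using A Z \<rho> by (simp add: sum_conductance field_simps flip: sum_divide_distrib)
    then have "?P {p, q} *\<^sub>R ?g {p, q} = ?w p q *\<^sub>R edge_laplacian (label p) (label q)"
      unfolding cast_update_edge using c[of p] c[of q] by (simp add: expanded_weight_def)
    then show "?P {(i, k), (j, l)} *\<^sub>R ?g {(i, k), (j, l)} =
        ?w (i, k) (j, l) *\<^sub>R edge_laplacian (label (i, k)) (label (j, l))"
      unfolding pq .
  qed
  finally show ?thesis .
qed

theorem theorem4p2:
  fixes a :: "'d::{finite,linorder} \<Rightarrow> real" and \<rho> :: nat
  assumes "CARD('d) \<ge> 2"
    and "\<And>i. a i > 0"
    and "\<rho> \<ge> 1"
  shows "measure_pmf.expectation (cast_tree a \<rho>) (cast_update a \<rho>) = schur_clique a"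
proof -
  let ?I = "{(i, j). i < j} :: ('d \<times> 'd) set" and ?K = "{1..\<rho>} \<times> {1..\<rho>}"
  let ?t = "\<lambda>i j. (a i / real \<rho> * (a j / real \<rho>) / sum a UNIV) *\<^sub>R edge_laplacian i j"
  have "measure_pmf.expectation (cast_tree a \<rho>) (cast_update a \<rho>) =
      (\<Sum>(p, q)\<in>{(p, q). p \<in> copies \<rho> \<and> q \<in> copies \<rho> \<and> label p < label q}.
        expanded_weight a \<rho> p q *\<^sub>R edge_laplacian (label p) (label q))"
    using assms(2,3) by (rule expectation_cast_update)
  \<comment> \<open>Pairs of copies are regrouped as a pair of labels and a pair of copy numbers;
    the summand depends on the labels only, so the \<rho> squared choices of numbers cancel the
    denominators of the conductances.\<close>
  also have "\<dots> = (\<Sum>((i, j), (k, l))\<in>?I \<times> ?K. ?t i j)"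
    by (rule sum.reindex_bij_witness[where i = "\<lambda>((i, j), (k, l)). ((i, k), (j, l))"
          and j = "\<lambda>((i, k), (j, l)). ((i, j), (k, l))"])
      (auto simp: copies_Times label_def conductance_def expanded_weight_def)
  also have "\<dots> = (\<Sum>(i, j)\<in>?I. \<Sum>(k, l)\<in>?K. ?t i j)"
    by (simp only: sum.cartesian_product case_prod_unfold)
  also have "\<dots> = (\<Sum>(i, j)\<in>?I. (real \<rho> * real \<rho>) *\<^sub>R ?t i j)"
    by (simp add: case_prod_unfold sum_constant_scaleR del: sum_constant)
  also have "\<dots> = schur_clique a"
    unfolding schur_clique_def using assms(3) by (intro sum.cong) auto
  finally show ?thesis .
qed

end
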